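(* $\mathit{TrHull}$ provides a functor from $\mathbf{Sem}_{nd}$ to $\mathbf{Mon}$, and $\mathfrak{M}=(\mathfrak{M}_{\mathsf{S}})_{\mathsf{S}}$ is a natural transformation $J\Rightarrow |-|\circ \mathit{TrHull}\colon \mathbf{Sem}_{nd}\to \mathbf{Sem}$, where $J\colon \mathbf{Sem}_{nd}\to \mathbf{Sem}$ is the canonical (non-full) embedding functor.
   Context: $\mathbf{Sem}$ and $\mathbf{Mon}$ are the categories of ordinary semigroups and monoids, $|-|\colon\mathbf{Mon}\to\mathbf{Sem}$ the forgetful functor. For a semigroup $\mathsf{S}=(S,* )$, $\mathsf{TrHull}(\mathsf{S})$ is the monoid of pairs $(L,R)$ of maps $S\to S$ with $L(x*y)=L(x)*y$, $R(x*y)=x*R(y)$ and $R(x)*y=x*L(y)$ for all $x,y\in S$, with product $(L',R')\star(L,R)=(L'\circ L,R\circ R')$ and identity $(id_S,id_S)$. The homomorphism of semigroups $\mathfrak{M}_{\mathsf{S}}\colon\mathsf{S}\to|\mathsf{TrHull}(\mathsf{S})|$ sends $x$ to $(y\mapsto x*y,\ y\mapsto y*x)$. A semigroup $(S,* )$ is globally idempotent when $S=\{x*y\colon x,y\in S\}$, and non-degenerate when ($x*y=x*z$ for all $x\in S$ implies $y=z$) and ($y*x=z*x$ for all $x\in S$ implies $y=z$). A homomorphism $f\colon(S,* )\to(T,\cdot)$ is non-degenerate when $T=\{f(s)\cdot t\colon s\in S,t\in T\}=\{t\cdot f(s)\colon s\in S,t\in T\}$. $\mathbf{Sem}_{nd}$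 is the subcategory of $\mathbf{Sem}$ whose objects are the globally idempotent and non-degenerate semigroups and whose morphisms are the non-degenerate homomorphisms of semigroups. $\mathit{TrHull}$ is given on objects by $\mathsf{S}\mapsto\mathsf{TrHull}(\mathsf{S})$, and on a non-degenerate homomorphism $f\colon\mathsf{S}\to\mathsf{T}$ (with $\mathsf{T}$ non-degenerate) $\mathit{TrHull}(f)\colon\mathsf{TrHull}(\mathsf{S})\to\mathsf{TrHull}(\mathsf{T})$ is the unique homomorphism of monoids such that $|\mathit{TrHull}(f)|\circ\mathfrak{M}_{\mathsf{S}}=\mathfrak{M}_{\mathsf{T}}\circ f$ (it exists and is unique). *)

theory Defs
  imports "HOL-Algebra.Group"
begin

section \<open>Categories, functors, natural transformations\<close>

record ('o, 'm) cat =
  Obj :: "'o set"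
  Arr :: "'m set"
  Dom :: "'m \<Rightarrow> 'o"
  Cod :: "'m \<Rightarrow> 'o"
  Ident :: "'o \<Rightarrow> 'm"
  Comp :: "'m \<Rightarrow> 'm \<Rightarrow> 'm"  (infixr \<open>\<cdot>\<index>\<close> 55)

locale category =
  fixes C :: "('o, 'm) cat" (structure)
  assumes Dom_closed: "f \<in> Arr C \<Longrightarrow> Dom C f \<in> Obj C"
    and Cod_closed: "f \<in> Arr C \<Longrightarrow> Cod C f \<in> Obj C"
    and Ident_closed: "a \<in> Obj C \<Longrightarrow> Ident C a \<in> Arr C"
    and Dom_Ident: "a \<in> Obj C \<Longrightarrow> Dom C (Ident C a) = a"
    and Cod_Ident: "a \<in> Obj C \<Longrightarrow> Cod C (Ident C a) = a"
    and Comp_closed: "\<lbrakk>f \<in> Arr C; g \<in> Arr C; Dom C g = Cod C f\<rbrakk> \<Longrightarrow> g \<cdot> f \<in> Arr C"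
    and Dom_Comp: "\<lbrakk>f \<in> Arr C; g \<in> Arr C; Dom C g = Cod C f\<rbrakk> \<Longrightarrow> Dom C (g \<cdot> f) = Dom C f"
    and Cod_Comp: "\<lbrakk>f \<in> Arr C; g \<in> Arr C; Dom C g = Cod C f\<rbrakk> \<Longrightarrow> Cod C (g \<cdot> f) = Cod C g"
    and Comp_Ident: "f \<in> Arr C \<Longrightarrow> f \<cdot> Ident C (Dom C f) = f"
    and Ident_Comp: "f \<in> Arr C \<Longrightarrow> Ident C (Cod C f) \<cdot> f = f"
    and Comp_assoc:
      "\<lbrakk>f \<in> Arr C; g \<in> Arr C; h \<in> Arr C; Dom C g = Cod C f; Dom C h = Cod C g\<rbrakk>
        \<Longrightarrow> (h \<cdot> g) \<cdot> f = h \<cdot> (g \<cdot> f)"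

record ('o, 'm, 'p, 'n) func =
  omap :: "'o \<Rightarrow> 'p"
  amap :: "'m \<Rightarrow> 'n"

locale is_functor = source: category C + target: category D
  for C :: "('o, 'm) cat" and D :: "('p, 'n) cat" and F :: "('o, 'm, 'p, 'n) func" +
  assumes omap_closed: "a \<in> Obj C \<Longrightarrow> omap F a \<in> Obj D"
    and amap_closed: "f \<in> Arr C \<Longrightarrow> amap F f \<in> Arr D"
    and Dom_amap: "f \<in> Arr C \<Longrightarrow> Dom D (amap F f) = omap F (Dom C f)"
    and Cod_amap: "f \<in> Arr C \<Longrightarrow> Cod D (amap F f) = omap F (Cod C f)"
    and amap_Ident: "a \<in> Obj C \<Longrightarrow> amap F (Ident C a) = Ident D (omap F a)"
    and amap_Comp: "\<lbrakk>f \<in> Arr C; g \<in> Arr C; Dom C g = Cod C f\<rbrakk>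
        \<Longrightarrow> amap F (g \<cdot>\<^bsub>C\<^esub> f) = amap F g \<cdot>\<^bsub>D\<^esub> amap F f"

definition fcomp :: "('p, 'n, 'q, 'k) func \<Rightarrow> ('o, 'm, 'p, 'n) func \<Rightarrow> ('o, 'm, 'q, 'k) func"
    (infixr \<open>\<circ>\<^sub>F\<close> 55) where
  "G \<circ>\<^sub>F F = \<lparr>omap = omap G \<circ> omap F, amap = amap G \<circ> amap F\<rparr>"

text \<open>Injective on objects and on arrows.\<close>

definition embedding_functor ::
    "('o, 'm) cat \<Rightarrow> ('p, 'n) cat \<Rightarrow> ('o, 'm, 'p, 'n) func \<Rightarrow> bool" where
  "embedding_functor C D F \<longleftrightarrow>
     is_functor C D F \<and> inj_on (omap F) (Obj C) \<and> inj_on (amap F) (Arr C)"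

definition full_functor ::
    "('o, 'm) cat \<Rightarrow> ('p, 'n) cat \<Rightarrow> ('o, 'm, 'p, 'n) func \<Rightarrow> bool" where
  "full_functor C D F \<longleftrightarrow>
     is_functor C D F \<and>
     (\<forall>a\<in>Obj C. \<forall>b\<in>Obj C. \<forall>g\<in>Arr D. Dom D g = omap F a \<and> Cod D g = omap F b \<longrightarrow>
        (\<exists>f\<in>Arr C. Dom C f = a \<and> Cod C f = b \<and> amap F f = g))"

locale natural_transformation = F: is_functor C D F + G: is_functor C D G
  for C :: "('o, 'm) cat" and D :: "('p, 'n) cat"
    and F :: "('o, 'm, 'p, 'n) func" and G :: "('o, 'm, 'p, 'n) func"
    and \<tau> :: "'o \<Rightarrow> 'n" +
  assumes component_closed: "a \<in> Obj C \<Longrightarrow> \<tau> a \<in> Arr D"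
    and Dom_component: "a \<in> Obj C \<Longrightarrow> Dom D (\<tau> a) = omap F a"
    and Cod_component: "a \<in> Obj C \<Longrightarrow> Cod D (\<tau> a) = omap G a"
    and naturality: "f \<in> Arr C
        \<Longrightarrow> amap G f \<cdot>\<^bsub>D\<^esub> \<tau> (Dom C f) = \<tau> (Cod C f) \<cdot>\<^bsub>D\<^esub> amap F f"


section \<open>Semigroups and monoids\<close>

text \<open>
  The carrier may be empty. As usual with carrier-based structures, the operation is a total
  function that is only constrained on the carrier; homomorphisms are required to be
  extensional, so that equality of homomorphisms is equality on the carrier.
\<close>

record 'a sgrp = "'a partial_object" +
  sop :: "'a \<Rightarrow> 'a \<Rightarrow> 'a"  (infixl \<open>\<star>\<index>\<close> 70)

definition is_sgrp :: "'a sgrp \<Rightarrow> bool" where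
  "is_sgrp S \<longleftrightarrow>
     (\<forall>x\<in>carrier S. \<forall>y\<in>carrier S. x \<star>\<^bsub>S\<^esub> y \<in> carrier S) \<and>
     (\<forall>x\<in>carrier S. \<forall>y\<in>carrier S. \<forall>z\<in>carrier S.
        (x \<star>\<^bsub>S\<^esub> y) \<star>\<^bsub>S\<^esub> z = x \<star>\<^bsub>S\<^esub> (y \<star>\<^bsub>S\<^esub> z))"

definition sgrp_hom :: "'a sgrp \<Rightarrow> 'b sgrp \<Rightarrow> ('a \<Rightarrow> 'b) set" where
  "sgrp_hom S T =
     {f \<in> carrier S \<rightarrow>\<^sub>E carrier T.
        \<forall>x\<in>carrier S. \<forall>y\<in>carrier S. f (x \<star>\<^bsub>S\<^esub> y) = f x \<star>\<^bsub>T\<^esub> f y}"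

definition mon_hom :: "'a monoid \<Rightarrow> 'b monoid \<Rightarrow> ('a \<Rightarrow> 'b) set" where
  "mon_hom M N = {h \<in> hom M N \<inter> extensional (carrier M). h \<one>\<^bsub>M\<^esub> = \<one>\<^bsub>N\<^esub>}"

definition forget :: "'a monoid \<Rightarrow> 'a sgrp" where
  "forget M = \<lparr>carrier = carrier M, sop = mult M\<rparr>"

definition globally_idempotent :: "'a sgrp \<Rightarrow> bool" where
  "globally_idempotent S \<longleftrightarrow> carrier S = {x \<star>\<^bsub>S\<^esub> y | x y. x \<in> carrier S \<and> y \<in> carrier S}"

definition nondegenerate :: "'a sgrp \<Rightarrow> bool" where
  "nondegenerate S \<longleftrightarrow>
     (\<forall>y\<in>carrier S. \<forall>z\<in>carrier S. (\<forall>x\<in>carrier S. x \<star>\<^bsub>S\<^esub> y = x \<star>\<^bsub>S\<^esub> z) \<longrightarrow> y = z) \<and>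
     (\<forall>y\<in>carrier S. \<forall>z\<in>carrier S. (\<forall>x\<in>carrier S. y \<star>\<^bsub>S\<^esub> x = z \<star>\<^bsub>S\<^esub> x) \<longrightarrow> y = z)"

definition nondegenerate_map :: "'a sgrp \<Rightarrow> 'b sgrp \<Rightarrow> ('a \<Rightarrow> 'b) \<Rightarrow> bool" where
  "nondegenerate_map S T f \<longleftrightarrow>
     carrier T = {f s \<star>\<^bsub>T\<^esub> t | s t. s \<in> carrier S \<and> t \<in> carrier T} \<and>
     carrier T = {t \<star>\<^bsub>T\<^esub> f s | s t. s \<in> carrier S \<and> t \<in> carrier T}"


section \<open>The translational hull\<close>

type_synonym 'a hull = "('a \<Rightarrow> 'a) \<times> ('a \<Rightarrow> 'a)"

definition TrHull :: "'a sgrp \<Rightarrow> 'a hull monoid" where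
  "TrHull S =
     \<lparr>carrier =
        {(L, R). L \<in> carrier S \<rightarrow>\<^sub>E carrier S \<and> R \<in> carrier S \<rightarrow>\<^sub>E carrier S \<and>
           (\<forall>x\<in>carrier S. \<forall>y\<in>carrier S.
              L (x \<star>\<^bsub>S\<^esub> y) = L x \<star>\<^bsub>S\<^esub> y \<and>
              R (x \<star>\<^bsub>S\<^esub> y) = x \<star>\<^bsub>S\<^esub> R y \<and>
              R x \<star>\<^bsub>S\<^esub> y = x \<star>\<^bsub>S\<^esub> L y)},
      mult = (\<lambda>(L', R') (L, R). (compose (carrier S) L' L, compose (carrier S) R R')),
      one = (\<lambda>x\<in>carrier S. x, \<lambda>x\<in>carrier S. x)\<rparr>"

definition hull_map :: "'a sgrp \<Rightarrow> 'a \<Rightarrow> 'a hull"  (\<open>\<MM>\<close>) where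
  "\<MM> S = (\<lambda>x\<in>carrier S. (\<lambda>y\<in>carrier S. x \<star>\<^bsub>S\<^esub> y, \<lambda>y\<in>carrier S. y \<star>\<^bsub>S\<^esub> x))"

definition TrHull_map :: "'a sgrp \<Rightarrow> 'b sgrp \<Rightarrow> ('a \<Rightarrow> 'b) \<Rightarrow> 'a hull \<Rightarrow> 'b hull" where
  "TrHull_map S T f =
     (THE h. h \<in> mon_hom (TrHull S) (TrHull T) \<and> (\<forall>x\<in>carrier S. h (\<MM> S x) = \<MM> T (f x)))"


section \<open>The categories and functors\<close>

record ('o, 'f) arrow =
  src :: 'o
  fn :: 'f
  trg :: 'o

definition concrete_cat ::
    "('o \<Rightarrow> 'a set) \<Rightarrow> 'o set \<Rightarrow> ('o \<Rightarrow> 'o \<Rightarrow> ('a \<Rightarrow> 'a) set) \<Rightarrow> ('o, ('o, 'a \<Rightarrow> 'a) arrow) cat" where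
  "concrete_cat U Ob H =
     \<lparr>Obj = Ob,
      Arr = {f. src f \<in> Ob \<and> trg f \<in> Ob \<and> fn f \<in> H (src f) (trg f)},
      Dom = src,
      Cod = trg,
      Ident = (\<lambda>A. \<lparr>src = A, fn = \<lambda>x\<in>U A. x, trg = A\<rparr>),
      Comp = (\<lambda>g f. \<lparr>src = src f, fn = compose (U (src f)) (fn g) (fn f), trg = trg g\<rparr>)\<rparr>"

type_synonym 'a sgrp_arrow = "('a sgrp, 'a \<Rightarrow> 'a) arrow"
type_synonym 'a mon_arrow = "('a monoid, 'a \<Rightarrow> 'a) arrow"

text \<open>Categories of the structures whose carrier is a set of elements of the type \<open>'a\<close>.\<close>

definition Sem :: "('a sgrp, 'a sgrp_arrow) cat" where
  "Sem = concrete_cat carrier {S. is_sgrp S} sgrp_hom"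

definition Mon :: "('a monoid, 'a mon_arrow) cat" where
  "Mon = concrete_cat carrier {M. monoid M} mon_hom"

definition Sem_nd :: "('a sgrp, 'a sgrp_arrow) cat" where
  "Sem_nd = concrete_cat carrier
     {S. is_sgrp S \<and> globally_idempotent S \<and> nondegenerate S}
     (\<lambda>S T. {f \<in> sgrp_hom S T. nondegenerate_map S T f})"

text \<open>The inclusion of \<open>Sem_nd\<close> into \<open>Sem\<close>.\<close>

definition J_functor :: "('a sgrp, 'a sgrp_arrow, 'a sgrp, 'a sgrp_arrow) func" where
  "J_functor = \<lparr>omap = id, amap = id\<rparr>"

definition forget_functor :: "('a monoid, 'a mon_arrow, 'a sgrp, 'a sgrp_arrow) func" where
  "forget_functor =
     \<lparr>omap = forget,
      amap = (\<lambda>h. \<lparr>src = forget (src h), fn = fn h, trg = forget (trg h)\<rparr>)\<rparr>"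

definition TrHull_functor :: "('a sgrp, 'a sgrp_arrow, 'a hull monoid, 'a hull mon_arrow) func" where
  "TrHull_functor =
     \<lparr>omap = TrHull,
      amap = (\<lambda>f. \<lparr>src = TrHull (src f), fn = TrHull_map (src f) (trg f) (fn f),
                     trg = TrHull (trg f)\<rparr>)\<rparr>"

text \<open>
  A semigroup on \<open>'a\<close> and its translational hull, on \<open>'a hull\<close>, are objects of one category of
  semigroups only after both element types have been embedded into a common type \<open>'u\<close>
  (for example \<open>'a + 'a hull\<close>). Along an injection \<open>\<iota> :: 'a \<Rightarrow> 'u\<close>, a semigroup on \<open>'a\<close> is
  identified with its isomorphic copy on a subset of \<open>'u\<close>, and a map between semigroups with
  the corresponding map between the copies.
\<close>

definition copy_sgrp :: "('a \<Rightarrow> 'u) \<Rightarrow> 'a sgrp \<Rightarrow> 'u sgrp" where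
  "copy_sgrp \<iota> S =
     \<lparr>carrier = \<iota> ` carrier S, sop = (\<lambda>x y. \<iota> (the_inv \<iota> x \<star>\<^bsub>S\<^esub> the_inv \<iota> y))\<rparr>"

definition copy_arrow ::
    "('a \<Rightarrow> 'u) \<Rightarrow> ('b \<Rightarrow> 'u) \<Rightarrow> 'a sgrp \<Rightarrow> 'b sgrp \<Rightarrow> ('a \<Rightarrow> 'b) \<Rightarrow> 'u sgrp_arrow" where
  "copy_arrow \<iota> \<kappa> S T f =
     \<lparr>src = copy_sgrp \<iota> S, fn = (\<lambda>x\<in>\<iota> ` carrier S. \<kappa> (f (the_inv \<iota> x))), trg = copy_sgrp \<kappa> T\<rparr>"

definition copy_functor :: "('a \<Rightarrow> 'u) \<Rightarrow> ('a sgrp, 'a sgrp_arrow, 'u sgrp, 'u sgrp_arrow) func" where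
  "copy_functor \<iota> =
     \<lparr>omap = copy_sgrp \<iota>, amap = (\<lambda>f. copy_arrow \<iota> \<iota> (src f) (trg f) (fn f))\<rparr>"

definition hull_component ::
    "('a \<Rightarrow> 'u) \<Rightarrow> ('a hull \<Rightarrow> 'u) \<Rightarrow> 'a sgrp \<Rightarrow> 'u sgrp_arrow" where
  "hull_component \<iota> \<kappa> S = copy_arrow \<iota> \<kappa> S (forget (TrHull S)) (\<MM> S)"

end

theory Submission
  imports Defs
begin

text \<open>
  If \<open>f\<close> is a nondegenerate homomorphism from \<open>S\<close> to \<open>T\<close>, every element of \<open>T\<close> has the forms
  \<open>f s \<star> t\<close> and \<open>t' \<star> f s'\<close>, so a bitranslation \<open>(L, R)\<close> of \<open>S\<close> extends to \<open>T\<close> in only one way: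
  by \<open>f s \<star> t \<mapsto> f (L s) \<star> t\<close> and \<open>t \<star> f s \<mapsto> t \<star> f (R s)\<close>. The first of these is well defined because
  \<open>t' \<star> f s' \<star> f (L s) \<star> t = t' \<star> f (R s') \<star> f s \<star> t\<close> depends only on \<open>f s \<star> t\<close>, and \<open>T\<close> is
  nondegenerate; the second is symmetric. On the other hand \<open>(L, R) \<star> \<MM> s = \<MM> (L s)\<close> and
  \<open>\<MM> s \<star> (L, R) = \<MM> (R s)\<close> in the translational hull, so any monoid homomorphism compatible with
  the maps \<open>\<MM>\<close> acts by these formulas. Functoriality is a consequence of this uniqueness.
  An example showing that the embedding is not full is the map from the empty semigroup to a
  one-element semigroup.
\<close>

section \<open>Concrete categories and composition of functors\<close>

text \<open>Because each \<open>H A B\<close> consists of extensional functions, the identity laws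
  and associativity hold as equalities of HOL functions. What remains for each particular category
  is that its morphisms contain the identities and are closed under composition.\<close>

lemma category_concrete_cat:
  assumes "\<And>A B. H A B \<subseteq> U A \<rightarrow>\<^sub>E U B"
    and "\<And>A. A \<in> Ob \<Longrightarrow> (\<lambda>x\<in>U A. x) \<in> H A A"
    and "\<And>A B C f g. \<lbrakk>A \<in> Ob; B \<in> Ob; C \<in> Ob; f \<in> H A B; g \<in> H B C\<rbrakk> \<Longrightarrow> compose (U A) g f \<in> H A C"
  shows "category (concrete_cat U Ob H)"
proof -
  have PiE: "f \<in> U A \<rightarrow>\<^sub>E U B" if "f \<in> H A B" for f A B
    using that assms(1) by blast
  show ?thesis
  proof (unfold_locales, goal_cases)
    case (9 f)
    then have "fn f \<in> U (src f) \<rightarrow>\<^sub>E U (trg f)"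
      by (intro PiE) (simp add: concrete_cat_def)
    then show ?case
      by (auto simp: concrete_cat_def PiE_iff intro!: arrow.equality compose_Id)
  next
    case (10 f)
    then have "fn f \<in> U (src f) \<rightarrow>\<^sub>E U (trg f)"
      by (intro PiE) (simp add: concrete_cat_def)
    then show ?case
      by (auto simp: concrete_cat_def PiE_iff Pi_iff intro!: arrow.equality Id_compose)
  next
    case (11 f g h)
    then have "fn f \<in> U (src f) \<rightarrow> U (src g)"
      using PiE by (fastforce simp: concrete_cat_def)
    then show ?case
      by (auto simp: concrete_cat_def compose_def fun_eq_iff Pi_iff)
  qed (use assms(2,3) in \<open>auto simp: concrete_cat_def\<close>)
qed

lemma is_functor_fcomp:
  assumes "is_functor C D F" and "is_functor D E G"
  shows "is_functor C E (G \<circ>\<^sub>F F)"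
proof -
  interpret F: is_functor C D F by fact
  interpret G: is_functor D E G by fact
  show ?thesis
    by unfold_locales
      (simp_all add: fcomp_def F.omap_closed F.amap_closed F.Dom_amap F.Cod_amap F.amap_Ident
        F.amap_Comp G.omap_closed G.amap_closed G.Dom_amap G.Cod_amap G.amap_Ident G.amap_Comp)
qed

section \<open>The categories of semigroups and of monoids\<close>

lemma category_Sem: "category (Sem :: ('a sgrp, 'a sgrp_arrow) cat)"
  unfolding Sem_def
proof (rule category_concrete_cat, goal_cases)
  case (3 A B C f g)
  then show ?case
    by (auto simp: sgrp_hom_def is_sgrp_def compose_def PiE_iff)
qed (auto simp: sgrp_hom_def is_sgrp_def)

lemma category_Mon: "category (Mon :: ('a monoid, 'a mon_arrow) cat)"
  unfolding Mon_def
proof (rule category_concrete_cat, goal_cases)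
  case (1 A B)
  then show ?case
    by (auto simp: mon_hom_def hom_def PiE_def)
next
  case (2 A)
  then show ?case
    by (simp add: mon_hom_def hom_def monoid.m_closed monoid.one_closed)
next
  case (3 A B C f g)
  then show ?case
    by (simp add: mon_hom_def hom_def compose_def Pi_iff monoid.m_closed monoid.one_closed)
qed

section \<open>Nondegenerate maps and the category they form\<close>

lemma nondegenerate_map_left:
  assumes "nondegenerate_map S T f" "y \<in> carrier T"
  obtains s t where "s \<in> carrier S" "t \<in> carrier T" "y = f s \<star>\<^bsub>T\<^esub> t"
proof -
  from assms(1) have "carrier T \<subseteq> {f s \<star>\<^bsub>T\<^esub> t | s t. s \<in> carrier S \<and> t \<in> carrier T}"
    unfolding nondegenerate_map_def by (elim conjE equalityD1)
  from subsetD[OF this assms(2)] show thesis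
    using that by auto
qed

lemma nondegenerate_map_right:
  assumes "nondegenerate_map S T f" "y \<in> carrier T"
  obtains s t where "s \<in> carrier S" "t \<in> carrier T" "y = t \<star>\<^bsub>T\<^esub> f s"
proof -
  from assms(1) have "carrier T \<subseteq> {t \<star>\<^bsub>T\<^esub> f s | s t. s \<in> carrier S \<and> t \<in> carrier T}"
    unfolding nondegenerate_map_def by (elim conjE equalityD1)
  from subsetD[OF this assms(2)] show thesis
    using that by auto
qed

text \<open>Factor twice: from \<open>u = g t \<star> u1\<close> and
  \<open>t = f s \<star> t1\<close> follows \<open>u = g (f s) \<star> (g t1 \<star> u1)\<close>,
  and symmetrically on the other side.\<close>

lemma nondegenerate_map_compose:
  assumes "is_sgrp U"
    and f: "f \<in> sgrp_hom S T" "nondegenerate_map S T f"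
    and g: "g \<in> sgrp_hom T U" "nondegenerate_map T U g"
  shows "nondegenerate_map S U (compose (carrier S) g f)"
proof -
  have cl: "f s \<in> carrier T" if "s \<in> carrier S" for s
    using f that by (auto simp: sgrp_hom_def)
  have cl': "g t \<in> carrier U" if "t \<in> carrier T" for t
    using g that by (auto simp: sgrp_hom_def)
  have hom: "g (x \<star>\<^bsub>T\<^esub> y) = g x \<star>\<^bsub>U\<^esub> g y" if "x \<in> carrier T" "y \<in> carrier T" for x y
    using g that by (auto simp: sgrp_hom_def)
  have m: "x \<star>\<^bsub>U\<^esub> y \<in> carrier U" if "x \<in> carrier U" "y \<in> carrier U" for x y
    using assms(1) that by (auto simp: is_sgrp_def)
  have a: "x \<star>\<^bsub>U\<^esub> y \<star>\<^bsub>U\<^esub> z = x \<star>\<^bsub>U\<^esub> (y \<star>\<^bsub>U\<^esub> z)"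
    if "x \<in> carrier U" "y \<in> carrier U" "z \<in> carrier U" for x y z
    using assms(1) that by (auto simp: is_sgrp_def)
  have "\<exists>s u'. u = g (f s) \<star>\<^bsub>U\<^esub> u' \<and> s \<in> carrier S \<and> u' \<in> carrier U"
    if u: "u \<in> carrier U" for u
  proof -
    obtain t u1 where 1: "t \<in> carrier T" "u1 \<in> carrier U" "u = g t \<star>\<^bsub>U\<^esub> u1"
      by (rule nondegenerate_map_left[OF g(2) u])
    obtain s t1 where 2: "s \<in> carrier S" "t1 \<in> carrier T" "t = f s \<star>\<^bsub>T\<^esub> t1"
      by (rule nondegenerate_map_left[OF f(2) 1(1)])
    have "u = g (f s) \<star>\<^bsub>U\<^esub> (g t1 \<star>\<^bsub>U\<^esub> u1)"
      using 1 2 by (simp add: hom a cl cl')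
    then show ?thesis
      using 1 2 by (intro exI[of _ s] exI[of _ "g t1 \<star>\<^bsub>U\<^esub> u1"]) (simp add: m cl')
  qed
  moreover have "\<exists>s u'. u = u' \<star>\<^bsub>U\<^esub> g (f s) \<and> s \<in> carrier S \<and> u' \<in> carrier U"
    if u: "u \<in> carrier U" for u
  proof -
    obtain t u1 where 1: "t \<in> carrier T" "u1 \<in> carrier U" "u = u1 \<star>\<^bsub>U\<^esub> g t"
      by (rule nondegenerate_map_right[OF g(2) u])
    obtain s t1 where 2: "s \<in> carrier S" "t1 \<in> carrier T" "t = t1 \<star>\<^bsub>T\<^esub> f s"
      by (rule nondegenerate_map_right[OF f(2) 1(1)])
    have "u = (u1 \<star>\<^bsub>U\<^esub> g t1) \<star>\<^bsub>U\<^esub> g (f s)"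
      using 1 2 by (simp add: hom a cl cl')
    then show ?thesis
      using 1 2 by (intro exI[of _ s] exI[of _ "u1 \<star>\<^bsub>U\<^esub> g t1"]) (simp add: m cl')
  qed
  ultimately show ?thesis
    unfolding nondegenerate_map_def
    by (intro conjI equalityI subsetI CollectI) (auto simp: compose_def m cl cl', metis+)
qed

text \<open>For the identity map, both conditions of nondegeneracy are global idempotence. This is
  how that condition on objects provides \<open>Sem_nd\<close> with identities.\<close>

lemma nondegenerate_map_id:
  assumes "globally_idempotent S"
  shows "nondegenerate_map S S (\<lambda>x\<in>carrier S. x)"
proof -
  have "{(\<lambda>x\<in>carrier S. x) s \<star>\<^bsub>S\<^esub> t | s t. s \<in> carrier S \<and> t \<in> carrier S}
      = {x \<star>\<^bsub>S\<^esub> y | x y. x \<in> carrier S \<and> y \<in> carrier S}"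
    by force
  moreover have "{t \<star>\<^bsub>S\<^esub> (\<lambda>x\<in>carrier S. x) s | s t. s \<in> carrier S \<and> t \<in> carrier S}
      = {x \<star>\<^bsub>S\<^esub> y | x y. x \<in> carrier S \<and> y \<in> carrier S}"
    by force
  ultimately show ?thesis
    using assms unfolding nondegenerate_map_def globally_idempotent_def by argo
qed

lemma category_Sem_nd: "category (Sem_nd :: ('a sgrp, 'a sgrp_arrow) cat)"
  unfolding Sem_nd_def
proof (rule category_concrete_cat)
  fix A B C :: "'a sgrp" and f g
  assume *: "A \<in> {S. is_sgrp S \<and> globally_idempotent S \<and> nondegenerate S}"
    "B \<in> {S. is_sgrp S \<and> globally_idempotent S \<and> nondegenerate S}"
    "C \<in> {S. is_sgrp S \<and> globally_idempotent S \<and> nondegenerate S}"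
    "f \<in> {f \<in> sgrp_hom A B. nondegenerate_map A B f}"
    "g \<in> {f \<in> sgrp_hom B C. nondegenerate_map B C f}"
  then have "compose (carrier A) g f \<in> sgrp_hom A C"
    by (auto simp: sgrp_hom_def is_sgrp_def compose_def PiE_iff)
  with * show "compose (carrier A) g f \<in> {f \<in> sgrp_hom A C. nondegenerate_map A C f}"
    using nondegenerate_map_compose by blast
qed (auto simp: sgrp_hom_def is_sgrp_def intro: nondegenerate_map_id)

section \<open>The translational hull\<close>

lemma TrHull_mult:
  "a \<otimes>\<^bsub>TrHull S\<^esub> b = (compose (carrier S) (fst a) (fst b), compose (carrier S) (snd b) (snd a))"
  by (simp add: TrHull_def split_beta)

lemma TrHull_one: "\<one>\<^bsub>TrHull S\<^esub> = (\<lambda>x\<in>carrier S. x, \<lambda>x\<in>carrier S. x)"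
  by (simp add: TrHull_def)

lemma TrHull_carrier_iff:
  "a \<in> carrier (TrHull S) \<longleftrightarrow>
     fst a \<in> carrier S \<rightarrow>\<^sub>E carrier S \<and> snd a \<in> carrier S \<rightarrow>\<^sub>E carrier S \<and>
     (\<forall>x\<in>carrier S. \<forall>y\<in>carrier S.
        fst a (x \<star>\<^bsub>S\<^esub> y) = fst a x \<star>\<^bsub>S\<^esub> y \<and>
        snd a (x \<star>\<^bsub>S\<^esub> y) = x \<star>\<^bsub>S\<^esub> snd a y \<and>
        snd a x \<star>\<^bsub>S\<^esub> y = x \<star>\<^bsub>S\<^esub> fst a y)"
  by (simp add: TrHull_def split_beta)

lemma TrHull_carrierD:
  assumes "a \<in> carrier (TrHull S)" "x \<in> carrier S"
  shows "fst a x \<in> carrier S" "snd a x \<in> carrier S"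
    and "y \<in> carrier S \<Longrightarrow> fst a (x \<star>\<^bsub>S\<^esub> y) = fst a x \<star>\<^bsub>S\<^esub> y"
    and "y \<in> carrier S \<Longrightarrow> snd a (x \<star>\<^bsub>S\<^esub> y) = x \<star>\<^bsub>S\<^esub> snd a y"
    and "y \<in> carrier S \<Longrightarrow> snd a x \<star>\<^bsub>S\<^esub> y = x \<star>\<^bsub>S\<^esub> fst a y"
  using assms by (auto simp: TrHull_carrier_iff)

text \<open>Both components are extensional on the carrier of \<open>S\<close>, so agreement there
  is equality of pairs.\<close>

lemma TrHull_eqI:
  assumes "a \<in> carrier (TrHull S)" "b \<in> carrier (TrHull S)"
    and "\<And>x. x \<in> carrier S \<Longrightarrow> fst a x = fst b x"
    and "\<And>x. x \<in> carrier S \<Longrightarrow> snd a x = snd b x"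
  shows "a = b"
proof (rule prod_eqI)
  show "fst a = fst b"
    using assms(1,2) by (intro PiE_ext[OF _ _ assms(3), where s = "\<lambda>_. carrier S"]) (simp_all add: TrHull_carrier_iff)
  show "snd a = snd b"
    using assms(1,2) by (intro PiE_ext[OF _ _ assms(4), where s = "\<lambda>_. carrier S"]) (simp_all add: TrHull_carrier_iff)
qed

text \<open>The linking condition survives products because the second components compose in the
  opposite order: \<open>R (R' x) \<star> y = R' x \<star> L y = x \<star> L' (L y)\<close>.\<close>

lemma monoid_TrHull:
  assumes "is_sgrp S"
  shows "monoid (TrHull S)"
proof (rule monoidI)
  show "\<one>\<^bsub>TrHull S\<^esub> \<in> carrier (TrHull S)"
    using assms by (auto simp: TrHull_carrier_iff TrHull_one is_sgrp_def)
next
  fix a b assume "a \<in> carrier (TrHull S)" "b \<in> carrier (TrHull S)"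
  then show "a \<otimes>\<^bsub>TrHull S\<^esub> b \<in> carrier (TrHull S)"
    using assms by (auto simp: TrHull_carrier_iff TrHull_mult is_sgrp_def compose_def PiE_iff)
next
  fix a b c
  assume "a \<in> carrier (TrHull S)" "b \<in> carrier (TrHull S)" "c \<in> carrier (TrHull S)"
  then show "a \<otimes>\<^bsub>TrHull S\<^esub> b \<otimes>\<^bsub>TrHull S\<^esub> c = a \<otimes>\<^bsub>TrHull S\<^esub> (b \<otimes>\<^bsub>TrHull S\<^esub> c)"
    by (auto simp: TrHull_mult compose_def fun_eq_iff TrHull_carrierD)
next
  fix a assume "a \<in> carrier (TrHull S)"
  then have "fst a \<in> carrier S \<rightarrow> carrier S" "fst a \<in> extensional (carrier S)"
    "snd a \<in> carrier S \<rightarrow> carrier S" "snd a \<in> extensional (carrier S)"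
    by (simp_all add: TrHull_carrier_iff PiE_def)
  then show "\<one>\<^bsub>TrHull S\<^esub> \<otimes>\<^bsub>TrHull S\<^esub> a = a" "a \<otimes>\<^bsub>TrHull S\<^esub> \<one>\<^bsub>TrHull S\<^esub> = a"
    by (simp_all add: TrHull_mult TrHull_one compose_Id Id_compose)
qed

section \<open>The canonical homomorphism into the translational hull\<close>

lemma hull_map_apply:
  assumes "x \<in> carrier S" "y \<in> carrier S"
  shows "fst (\<MM> S x) y = x \<star>\<^bsub>S\<^esub> y" "snd (\<MM> S x) y = y \<star>\<^bsub>S\<^esub> x"
  using assms by (auto simp: hull_map_def)

lemma hull_map_closed:
  assumes "is_sgrp S" "x \<in> carrier S"
  shows "\<MM> S x \<in> carrier (TrHull S)"
  using assms by (auto simp: TrHull_carrier_iff hull_map_def is_sgrp_def)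

text \<open>Associativity in both components: right multiplication by \<open>x \<star> y\<close>
  multiplies by \<open>x\<close> first and by \<open>y\<close> second, in accordance with the
  reversed composition of second components.\<close>

lemma hull_map_sgrp_hom:
  assumes "is_sgrp S"
  shows "\<MM> S \<in> sgrp_hom S (forget (TrHull S))"
proof -
  have "\<MM> S (x \<star>\<^bsub>S\<^esub> y) = \<MM> S x \<otimes>\<^bsub>TrHull S\<^esub> \<MM> S y" if "x \<in> carrier S" "y \<in> carrier S" for x y
    using that assms by (auto simp: TrHull_mult hull_map_def is_sgrp_def compose_def fun_eq_iff)
  then show ?thesis
    using assms by (auto simp: sgrp_hom_def forget_def hull_map_closed) (simp add: hull_map_def)
qed

text \<open>For \<open>a = (L, R)\<close>, the first identity rests on
  \<open>L (s \<star> y) = L s \<star> y\<close> and \<open>R y \<star> s = y \<star> L s\<close>;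
  the second is dual. Thus the image of \<MM> is a two-sided ideal, which ties the action of
  \<open>a\<close> on \<open>S\<close> to products in the hull.\<close>

lemma TrHull_mult_hull_map:
  assumes "is_sgrp S" "a \<in> carrier (TrHull S)" "s \<in> carrier S"
  shows "a \<otimes>\<^bsub>TrHull S\<^esub> \<MM> S s = \<MM> S (fst a s)"
    and "\<MM> S s \<otimes>\<^bsub>TrHull S\<^esub> a = \<MM> S (snd a s)"
  using assms
  by (auto simp: TrHull_mult hull_map_def compose_def fun_eq_iff TrHull_carrierD)

section \<open>Extension of bitranslations along nondegenerate homomorphisms\<close>

text \<open>The setting in which \<open>TrHull_map\<close> is determined: \<open>f_nd\<close>
  supplies the factorizations in \<open>T\<close> on which existence and uniqueness of extensions
  rest, and \<open>T_nd\<close> makes the extension independent of the factorization.\<close>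

locale nondegenerate_hom =
  fixes S :: "'a sgrp" and T :: "'b sgrp" and f :: "'a \<Rightarrow> 'b"
  assumes S: "is_sgrp S" and T: "is_sgrp T" and T_nd: "nondegenerate T"
    and f: "f \<in> sgrp_hom S T" and f_nd: "nondegenerate_map S T f"
begin

lemma f_closed [simp]: "s \<in> carrier S \<Longrightarrow> f s \<in> carrier T"
  using f by (auto simp: sgrp_hom_def)

lemma f_mult: "\<lbrakk>x \<in> carrier S; y \<in> carrier S\<rbrakk> \<Longrightarrow> f (x \<star>\<^bsub>S\<^esub> y) = f x \<star>\<^bsub>T\<^esub> f y"
  using f by (auto simp: sgrp_hom_def)

lemma T_closed [simp]: "\<lbrakk>x \<in> carrier T; y \<in> carrier T\<rbrakk> \<Longrightarrow> x \<star>\<^bsub>T\<^esub> y \<in> carrier T"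
  using T by (auto simp: is_sgrp_def)

lemma T_assoc: "\<lbrakk>x \<in> carrier T; y \<in> carrier T; z \<in> carrier T\<rbrakk>
    \<Longrightarrow> x \<star>\<^bsub>T\<^esub> y \<star>\<^bsub>T\<^esub> z = x \<star>\<^bsub>T\<^esub> (y \<star>\<^bsub>T\<^esub> z)"
  using T by (auto simp: is_sgrp_def)

lemma left_factor:
  assumes "y \<in> carrier T"
  obtains s t where "s \<in> carrier S" "t \<in> carrier T" "y = f s \<star>\<^bsub>T\<^esub> t"
  by (rule nondegenerate_map_left[OF f_nd assms])

lemma right_factor:
  assumes "y \<in> carrier T"
  obtains s t where "s \<in> carrier S" "t \<in> carrier T" "y = t \<star>\<^bsub>T\<^esub> f s"
  by (rule nondegenerate_map_right[OF f_nd assms])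

text \<open>Apply \<open>f\<close> to the linking condition
  \<open>s' \<star> L s = R s' \<star> s\<close>, then multiply by \<open>t'\<close> on the left and
  by \<open>t\<close> on the right.\<close>

lemma middle_exchange:
  assumes "a \<in> carrier (TrHull S)" "s \<in> carrier S" "s' \<in> carrier S" "t \<in> carrier T" "t' \<in> carrier T"
  shows "(t' \<star>\<^bsub>T\<^esub> f s') \<star>\<^bsub>T\<^esub> (f (fst a s) \<star>\<^bsub>T\<^esub> t) = (t' \<star>\<^bsub>T\<^esub> f (snd a s')) \<star>\<^bsub>T\<^esub> (f s \<star>\<^bsub>T\<^esub> t)"
proof -
  have "f s' \<star>\<^bsub>T\<^esub> f (fst a s) = f (snd a s') \<star>\<^bsub>T\<^esub> f s"
    using TrHull_carrierD[OF assms(1)] assms by (metis f_mult)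
  then have "f s' \<star>\<^bsub>T\<^esub> (f (fst a s) \<star>\<^bsub>T\<^esub> t) = f (snd a s') \<star>\<^bsub>T\<^esub> (f s \<star>\<^bsub>T\<^esub> t)"
    using assms by (metis T_assoc TrHull_carrierD(1,2) f_closed)
  then show ?thesis
    using assms by (simp add: T_assoc TrHull_carrierD(1,2))
qed

text \<open>The graph of the induced map of hulls. As a relation it prescribes values for all
  factorizations at once, and equations between values of the map reduce to
  \<open>extends_unique\<close>.\<close>

definition extends :: "'a hull \<Rightarrow> 'b hull \<Rightarrow> bool" where
  "extends a b \<longleftrightarrow> b \<in> carrier (TrHull T) \<and>
     (\<forall>s\<in>carrier S. \<forall>t\<in>carrier T.
        fst b (f s \<star>\<^bsub>T\<^esub> t) = f (fst a s) \<star>\<^bsub>T\<^esub> t \<and> snd b (t \<star>\<^bsub>T\<^esub> f s) = t \<star>\<^bsub>T\<^esub> f (snd a s))"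

text \<open>Every element of \<open>T\<close> factors both as \<open>f s \<star> t\<close> and as
  \<open>t \<star> f s\<close>, so each component is prescribed everywhere on
  \<open>T\<close>.\<close>

lemma extends_unique:
  assumes "extends a b" "extends a c"
  shows "b = c"
proof (rule TrHull_eqI)
  fix x assume x: "x \<in> carrier T"
  show "fst b x = fst c x"
    using x by (rule left_factor) (use assms in \<open>simp add: extends_def\<close>)
  show "snd b x = snd c x"
    using x by (rule right_factor) (use assms in \<open>simp add: extends_def\<close>)
qed (use assms in \<open>auto simp: extends_def\<close>)

text \<open>The point is independence of the factorization: after multiplication on the left by any
  \<open>u = t' \<star> f s'\<close>, \<open>middle_exchange\<close> expresses the candidate value
  through \<open>f s \<star> t\<close> alone, and nondegeneracy of \<open>T\<close> cancels
  \<open>u\<close>.\<close>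

lemma left_extension:
  assumes a: "a \<in> carrier (TrHull S)"
  obtains L where "L \<in> carrier T \<rightarrow>\<^sub>E carrier T"
    and "\<And>s t. \<lbrakk>s \<in> carrier S; t \<in> carrier T\<rbrakk> \<Longrightarrow> L (f s \<star>\<^bsub>T\<^esub> t) = f (fst a s) \<star>\<^bsub>T\<^esub> t"
proof -
  have wd: "f (fst a s) \<star>\<^bsub>T\<^esub> t = f (fst a s1) \<star>\<^bsub>T\<^esub> t1"
    if c: "s \<in> carrier S" "t \<in> carrier T" "s1 \<in> carrier S" "t1 \<in> carrier T"
      and eq: "f s \<star>\<^bsub>T\<^esub> t = f s1 \<star>\<^bsub>T\<^esub> t1" for s t s1 t1
  proof -
    have "u \<star>\<^bsub>T\<^esub> (f (fst a s) \<star>\<^bsub>T\<^esub> t) = u \<star>\<^bsub>T\<^esub> (f (fst a s1) \<star>\<^bsub>T\<^esub> t1)" if "u \<in> carrier T" for u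
      using that by (rule right_factor) (use a c eq in \<open>simp add: middle_exchange\<close>)
    moreover have "f (fst a s) \<star>\<^bsub>T\<^esub> t \<in> carrier T" "f (fst a s1) \<star>\<^bsub>T\<^esub> t1 \<in> carrier T"
      using a c by (simp_all add: TrHull_carrierD(1))
    ultimately show ?thesis
      using T_nd unfolding nondegenerate_def by blast
  qed
  \<comment> \<open>The value is characterized over all factorizations of \<open>y\<close>, so that
    the function obtained by choice satisfies the formula for every pair \<open>s\<close>,
    \<open>t\<close>.\<close>
  have "\<forall>y\<in>carrier T. \<exists>z. z \<in> carrier T \<and>
      (\<forall>s\<in>carrier S. \<forall>t\<in>carrier T. y = f s \<star>\<^bsub>T\<^esub> t \<longrightarrow> z = f (fst a s) \<star>\<^bsub>T\<^esub> t)"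
  proof
    fix y assume "y \<in> carrier T"
    then obtain s t where st: "s \<in> carrier S" "t \<in> carrier T" "y = f s \<star>\<^bsub>T\<^esub> t"
      by (rule left_factor)
    have "f (fst a s) \<star>\<^bsub>T\<^esub> t \<in> carrier T"
      using st a by (simp add: TrHull_carrierD(1))
    moreover have "f (fst a s) \<star>\<^bsub>T\<^esub> t = f (fst a s1) \<star>\<^bsub>T\<^esub> t1"
      if "s1 \<in> carrier S" "t1 \<in> carrier T" "y = f s1 \<star>\<^bsub>T\<^esub> t1" for s1 t1
      by (rule wd) (use st that in auto)
    ultimately show "\<exists>z. z \<in> carrier T \<and>
        (\<forall>s\<in>carrier S. \<forall>t\<in>carrier T. y = f s \<star>\<^bsub>T\<^esub> t \<longrightarrow> z = f (fst a s) \<star>\<^bsub>T\<^esub> t)"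
      by blast
  qed
  then obtain L where L: "\<forall>y\<in>carrier T. L y \<in> carrier T \<and>
      (\<forall>s\<in>carrier S. \<forall>t\<in>carrier T. y = f s \<star>\<^bsub>T\<^esub> t \<longrightarrow> L y = f (fst a s) \<star>\<^bsub>T\<^esub> t)"
    by (rule bchoice[THEN exE])
  show ?thesis
  \<comment> \<open>Restriction makes the chosen function extensional, as components of hull
    elements must be.\<close>
  proof (rule that[of "restrict L (carrier T)"])
    show "restrict L (carrier T) \<in> carrier T \<rightarrow>\<^sub>E carrier T"
      using L by auto
    show "restrict L (carrier T) (f s \<star>\<^bsub>T\<^esub> t) = f (fst a s) \<star>\<^bsub>T\<^esub> t" if "s \<in> carrier S" "t \<in> carrier T" for s t
      using bspec[OF L, of "f s \<star>\<^bsub>T\<^esub> t"] that by simp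
  qed
qed

text \<open>Dual to \<open>left_extension\<close>: multiply on the right by
  \<open>u = f s' \<star> t'\<close>, read \<open>middle_exchange\<close> from right to left, and
  cancel \<open>u\<close> by the other half of nondegeneracy.\<close>

lemma right_extension:
  assumes a: "a \<in> carrier (TrHull S)"
  obtains R where "R \<in> carrier T \<rightarrow>\<^sub>E carrier T"
    and "\<And>s t. \<lbrakk>s \<in> carrier S; t \<in> carrier T\<rbrakk> \<Longrightarrow> R (t \<star>\<^bsub>T\<^esub> f s) = t \<star>\<^bsub>T\<^esub> f (snd a s)"
proof -
  have wd: "t \<star>\<^bsub>T\<^esub> f (snd a s) = t1 \<star>\<^bsub>T\<^esub> f (snd a s1)"
    if c: "s \<in> carrier S" "t \<in> carrier T" "s1 \<in> carrier S" "t1 \<in> carrier T"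
      and eq: "t \<star>\<^bsub>T\<^esub> f s = t1 \<star>\<^bsub>T\<^esub> f s1" for s t s1 t1
  proof -
    have "(t \<star>\<^bsub>T\<^esub> f (snd a s)) \<star>\<^bsub>T\<^esub> u = (t1 \<star>\<^bsub>T\<^esub> f (snd a s1)) \<star>\<^bsub>T\<^esub> u" if "u \<in> carrier T" for u
      using that by (rule left_factor) (use a c eq in \<open>simp add: middle_exchange[symmetric]\<close>)
    moreover have "t \<star>\<^bsub>T\<^esub> f (snd a s) \<in> carrier T" "t1 \<star>\<^bsub>T\<^esub> f (snd a s1) \<in> carrier T"
      using a c by (simp_all add: TrHull_carrierD(2))
    ultimately show ?thesis
      using T_nd unfolding nondegenerate_def by blast
  qed
  have "\<forall>y\<in>carrier T. \<exists>z. z \<in> carrier T \<and>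
      (\<forall>s\<in>carrier S. \<forall>t\<in>carrier T. y = t \<star>\<^bsub>T\<^esub> f s \<longrightarrow> z = t \<star>\<^bsub>T\<^esub> f (snd a s))"
  proof
    fix y assume "y \<in> carrier T"
    then obtain s t where st: "s \<in> carrier S" "t \<in> carrier T" "y = t \<star>\<^bsub>T\<^esub> f s"
      by (rule right_factor)
    have "t \<star>\<^bsub>T\<^esub> f (snd a s) \<in> carrier T"
      using st a by (simp add: TrHull_carrierD(2))
    moreover have "t \<star>\<^bsub>T\<^esub> f (snd a s) = t1 \<star>\<^bsub>T\<^esub> f (snd a s1)"
      if "s1 \<in> carrier S" "t1 \<in> carrier T" "y = t1 \<star>\<^bsub>T\<^esub> f s1" for s1 t1
      by (rule wd) (use st that in auto)
    ultimately show "\<exists>z. z \<in> carrier T \<and>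
        (\<forall>s\<in>carrier S. \<forall>t\<in>carrier T. y = t \<star>\<^bsub>T\<^esub> f s \<longrightarrow> z = t \<star>\<^bsub>T\<^esub> f (snd a s))"
      by blast
  qed
  then obtain R where R: "\<forall>y\<in>carrier T. R y \<in> carrier T \<and>
      (\<forall>s\<in>carrier S. \<forall>t\<in>carrier T. y = t \<star>\<^bsub>T\<^esub> f s \<longrightarrow> R y = t \<star>\<^bsub>T\<^esub> f (snd a s))"
    by (rule bchoice[THEN exE])
  show ?thesis
  proof (rule that[of "restrict R (carrier T)"])
    show "restrict R (carrier T) \<in> carrier T \<rightarrow>\<^sub>E carrier T"
      using R by auto
    show "restrict R (carrier T) (t \<star>\<^bsub>T\<^esub> f s) = t \<star>\<^bsub>T\<^esub> f (snd a s)" if "s \<in> carrier S" "t \<in> carrier T" for s t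
      using bspec[OF R, of "t \<star>\<^bsub>T\<^esub> f s"] that by simp
  qed
qed

text \<open>The two extensions form a bitranslation. Each translation law follows from associativity
  after factoring the argument nearest to the map; the linking law for
  \<open>x = t' \<star> f s'\<close> and \<open>y = f s \<star> t\<close> is
  \<open>middle_exchange\<close>.\<close>

lemma extends_exists:
  assumes a: "a \<in> carrier (TrHull S)"
  shows "\<exists>b. extends a b"
proof -
  obtain L where L: "L \<in> carrier T \<rightarrow>\<^sub>E carrier T"
    "\<And>s t. \<lbrakk>s \<in> carrier S; t \<in> carrier T\<rbrakk> \<Longrightarrow> L (f s \<star>\<^bsub>T\<^esub> t) = f (fst a s) \<star>\<^bsub>T\<^esub> t"
    using left_extension[OF a] by blast
  obtain R where R: "R \<in> carrier T \<rightarrow>\<^sub>E carrier T"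
    "\<And>s t. \<lbrakk>s \<in> carrier S; t \<in> carrier T\<rbrakk> \<Longrightarrow> R (t \<star>\<^bsub>T\<^esub> f s) = t \<star>\<^bsub>T\<^esub> f (snd a s)"
    using right_extension[OF a] by blast
  note cl = TrHull_carrierD(1,2)[OF a]
  have "L (x \<star>\<^bsub>T\<^esub> y) = L x \<star>\<^bsub>T\<^esub> y" if "x \<in> carrier T" "y \<in> carrier T" for x y
    using that(1) by (rule left_factor) (use that(2) in \<open>simp add: T_assoc L cl\<close>)
  moreover have "R (x \<star>\<^bsub>T\<^esub> y) = x \<star>\<^bsub>T\<^esub> R y" if "x \<in> carrier T" "y \<in> carrier T" for x y
    using that(2)
    by (rule right_factor) (use that(1) in \<open>simp add: T_assoc[symmetric] R cl\<close>)
  moreover have "R x \<star>\<^bsub>T\<^esub> y = x \<star>\<^bsub>T\<^esub> L y" if "x \<in> carrier T" "y \<in> carrier T" for x y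
    using that(1)
  proof (rule right_factor)
    fix s' t' assume 1: "s' \<in> carrier S" "t' \<in> carrier T" "x = t' \<star>\<^bsub>T\<^esub> f s'"
    show ?thesis
      using that(2) by (rule left_factor) (use 1 a in \<open>simp add: L R middle_exchange\<close>)
  qed
  ultimately have "extends a (L, R)"
    using L R by (simp add: extends_def TrHull_carrier_iff)
  then show ?thesis ..
qed

section \<open>Extension as a homomorphism of monoids\<close>

lemma extends_one: "extends \<one>\<^bsub>TrHull S\<^esub> \<one>\<^bsub>TrHull T\<^esub>"
  using monoid.one_closed[OF monoid_TrHull[OF T]] by (simp add: extends_def TrHull_one)

lemma extends_mult:
  assumes "a \<in> carrier (TrHull S)" "a' \<in> carrier (TrHull S)" "extends a b" "extends a' b'"
  shows "extends (a \<otimes>\<^bsub>TrHull S\<^esub> a') (b \<otimes>\<^bsub>TrHull T\<^esub> b')"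
  using assms monoid.m_closed[OF monoid_TrHull[OF T]]
  by (simp add: extends_def TrHull_mult compose_def TrHull_carrierD(1,2))

lemma extends_hull_map:
  assumes "s \<in> carrier S"
  shows "extends (\<MM> S s) (\<MM> T (f s))"
  using assms by (simp add: extends_def hull_map_closed[OF T] hull_map_apply f_mult T_assoc)

text \<open>Apply \<open>h\<close> to \<open>a \<otimes> \<MM> s = \<MM> (L s)\<close> and rewrite
  the product in the hull of \<open>T\<close>: this gives
  \<open>\<MM> (fst (h a) (f s)) = \<MM> (f (L s))\<close>. Evaluation at \<open>t\<close> yields
  the formula for the first component; \<open>\<MM> s \<otimes> a\<close> gives the second.\<close>

lemma extends_compatible_hom:
  assumes h: "h \<in> mon_hom (TrHull S) (TrHull T)" "\<forall>x\<in>carrier S. h (\<MM> S x) = \<MM> T (f x)"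
    and a: "a \<in> carrier (TrHull S)"
  shows "extends a (h a)"
proof -
  have ha: "h a \<in> carrier (TrHull T)"
    using h a by (auto simp: mon_hom_def hom_def)
  have hm: "h (x \<otimes>\<^bsub>TrHull S\<^esub> y) = h x \<otimes>\<^bsub>TrHull T\<^esub> h y"
    if "x \<in> carrier (TrHull S)" "y \<in> carrier (TrHull S)" for x y
    using h that by (auto simp: mon_hom_def hom_def)
  have "\<MM> T (fst (h a) (f s)) = \<MM> T (f (fst a s))"
    and "\<MM> T (snd (h a) (f s)) = \<MM> T (f (snd a s))" if "s \<in> carrier S" for s
    using that hm[OF a hull_map_closed[OF S that]] hm[OF hull_map_closed[OF S that] a] h(2) a ha
    by (simp_all add: TrHull_mult_hull_map S T TrHull_carrierD(1,2))
  then have "fst (h a) (f s) \<star>\<^bsub>T\<^esub> t = f (fst a s) \<star>\<^bsub>T\<^esub> t"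
    and "t \<star>\<^bsub>T\<^esub> snd (h a) (f s) = t \<star>\<^bsub>T\<^esub> f (snd a s)"
    if "s \<in> carrier S" "t \<in> carrier T" for s t
    using that a ha by (metis f_closed hull_map_apply TrHull_carrierD(1,2))+
  then show ?thesis
    using ha by (simp add: extends_def TrHull_carrierD)
qed

lemma compatible_hom_unique:
  assumes "h \<in> mon_hom (TrHull S) (TrHull T)" "\<forall>x\<in>carrier S. h (\<MM> S x) = \<MM> T (f x)"
    and "k \<in> mon_hom (TrHull S) (TrHull T)" "\<forall>x\<in>carrier S. k (\<MM> S x) = \<MM> T (f x)"
  shows "h = k"
proof (rule extensionalityI)
  show "h a = k a" if "a \<in> carrier (TrHull S)" for a
    by (rule extends_unique[OF extends_compatible_hom[OF assms(1,2) that]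
          extends_compatible_hom[OF assms(3,4) that]])
qed (use assms in \<open>auto simp: mon_hom_def\<close>)

text \<open>Choose an extension \<open>h a\<close> of every \<open>a\<close>. Each law for
  \<open>h\<close> equates two extensions of the same element, so \<open>extends_unique\<close>
  proves it; restricting \<open>h\<close> to the hull makes it extensional.\<close>

lemma compatible_hom_exists:
  "\<exists>h. h \<in> mon_hom (TrHull S) (TrHull T) \<and> (\<forall>x\<in>carrier S. h (\<MM> S x) = \<MM> T (f x))"
proof -
  interpret S: monoid "TrHull S" by (rule monoid_TrHull[OF S])
  have "\<forall>a\<in>carrier (TrHull S). \<exists>b. extends a b"
    using extends_exists by blast
  then obtain h where h: "\<forall>a\<in>carrier (TrHull S). extends a (h a)"
    by (rule bchoice[THEN exE])
  have "h (a \<otimes>\<^bsub>TrHull S\<^esub> b) = h a \<otimes>\<^bsub>TrHull T\<^esub> h b"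
    if "a \<in> carrier (TrHull S)" "b \<in> carrier (TrHull S)" for a b
    using that h by (intro extends_unique[OF _ extends_mult[OF that]]) simp_all
  moreover have "h \<one>\<^bsub>TrHull S\<^esub> = \<one>\<^bsub>TrHull T\<^esub>"
    using h by (intro extends_unique[OF _ extends_one]) simp
  moreover have "h a \<in> carrier (TrHull T)" if "a \<in> carrier (TrHull S)" for a
    using h that by (simp add: extends_def)
  moreover have "h (\<MM> S x) = \<MM> T (f x)" if "x \<in> carrier S" for x
    using that h by (intro extends_unique[OF _ extends_hull_map]) (simp_all add: hull_map_closed S)
  ultimately show ?thesis
    by (intro exI[of _ "restrict h (carrier (TrHull S))"])
      (simp add: mon_hom_def hom_def hull_map_closed[OF S])
qed

text \<open>Unique existence turns the definite description behind \<open>TrHull_map\<close> into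
  its two characteristic properties.\<close>

lemma TrHull_map:
  shows "TrHull_map S T f \<in> mon_hom (TrHull S) (TrHull T)"
    and "x \<in> carrier S \<Longrightarrow> TrHull_map S T f (\<MM> S x) = \<MM> T (f x)"
proof -
  have "\<exists>!h. h \<in> mon_hom (TrHull S) (TrHull T) \<and> (\<forall>x\<in>carrier S. h (\<MM> S x) = \<MM> T (f x))"
    using compatible_hom_exists compatible_hom_unique by blast
  from theI'[OF this]
  show "TrHull_map S T f \<in> mon_hom (TrHull S) (TrHull T)"
    and "x \<in> carrier S \<Longrightarrow> TrHull_map S T f (\<MM> S x) = \<MM> T (f x)"
    by (auto simp: TrHull_map_def)
qed

text \<open>The form of uniqueness used for the functor laws: a candidate need only be a monoid
  homomorphism compatible with \<MM>.\<close>

lemma TrHull_map_eqI: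
  assumes "h \<in> mon_hom (TrHull S) (TrHull T)" "\<And>x. x \<in> carrier S \<Longrightarrow> h (\<MM> S x) = \<MM> T (f x)"
  shows "TrHull_map S T f = h"
  using compatible_hom_unique TrHull_map assms by blast

end

section \<open>The functors\<close>

lemma Sem_nd_arrow:
  assumes "f \<in> Arr Sem_nd"
  shows "nondegenerate_hom (src f) (trg f) (fn f)"
  using assms by (simp add: Sem_nd_def concrete_cat_def nondegenerate_hom_def)

lemma Mon_arrow:
  assumes "h \<in> Arr Mon"
  shows "fn h \<in> mon_hom (src h) (trg h)"
  using assms by (simp add: Mon_def concrete_cat_def)

lemma is_functor_TrHull: "is_functor Sem_nd Mon TrHull_functor"
proof -
  interpret nd: category Sem_nd by (rule category_Sem_nd)
  interpret Mon: category Mon by (rule category_Mon)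
  have closed: "amap TrHull_functor f \<in> Arr Mon" if "f \<in> Arr Sem_nd" for f :: "'a sgrp_arrow"
  proof -
    interpret nondegenerate_hom "src f" "trg f" "fn f" by (rule Sem_nd_arrow[OF that])
    show ?thesis
      using TrHull_map by (simp add: TrHull_functor_def Mon_def concrete_cat_def monoid_TrHull S T)
  qed
  show ?thesis
  proof (unfold_locales, goal_cases)
    case (1 a)
    then show ?case
      by (simp add: Sem_nd_def Mon_def concrete_cat_def TrHull_functor_def monoid_TrHull)
  next
    case (2 f)
    then show ?case by (rule closed)
  next
    case (3 f)
    then show ?case by (simp add: Sem_nd_def Mon_def concrete_cat_def TrHull_functor_def)
  next
    case (4 f)
    then show ?case by (simp add: Sem_nd_def Mon_def concrete_cat_def TrHull_functor_def)
  next
    case (5 a)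
    let ?i = "\<lambda>x\<in>carrier a. x"
    \<comment> \<open>Identities are arrows of \<open>Sem_nd\<close>; global idempotence of
      \<open>a\<close> enters through \<open>nd.Ident_closed\<close>.\<close>
    interpret nondegenerate_hom a a ?i
      using Sem_nd_arrow[OF nd.Ident_closed[OF 5]] by (simp add: Sem_nd_def concrete_cat_def)
    interpret monoid "TrHull a" by (rule monoid_TrHull[OF S])
    have "TrHull_map a a ?i = (\<lambda>x\<in>carrier (TrHull a). x)"
      by (rule TrHull_map_eqI) (auto simp: mon_hom_def hom_def hull_map_closed S)
    then show ?case
      by (simp add: Sem_nd_def Mon_def concrete_cat_def TrHull_functor_def)
  next
    case (6 f g)
    have fg: "trg f = src g"
      using 6 by (simp add: Sem_nd_def concrete_cat_def)
    let ?gf = "compose (carrier (src f)) (fn g) (fn f)"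
    interpret f: nondegenerate_hom "src f" "src g" "fn f"
      using Sem_nd_arrow[OF 6(1)] fg by simp
    interpret g: nondegenerate_hom "src g" "trg g" "fn g" by (rule Sem_nd_arrow[OF 6(2)])
    interpret gf: nondegenerate_hom "src f" "trg g" ?gf
      using Sem_nd_arrow[OF nd.Comp_closed[OF 6]] by (simp add: Sem_nd_def concrete_cat_def)
    let ?h = "compose (carrier (TrHull (src f)))
        (TrHull_map (src g) (trg g) (fn g)) (TrHull_map (src f) (src g) (fn f))"
    have "TrHull_map (src f) (trg g) ?gf = ?h"
    proof (rule gf.TrHull_map_eqI)
      show "?h \<in> mon_hom (TrHull (src f)) (TrHull (trg g))"
        \<comment> \<open>\<open>?h\<close> is the underlying map of a composite of two arrows of
          \<open>Mon\<close>, hence a monoid homomorphism.\<close>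
        using Mon_arrow[OF Mon.Comp_closed[OF closed[OF 6(1)] closed[OF 6(2)]]] fg
        by (simp add: Mon_def concrete_cat_def TrHull_functor_def)
    next
      fix x assume "x \<in> carrier (src f)"
      then show "?h (\<MM> (src f) x) = \<MM> (trg g) (?gf x)"
        by (simp add: compose_def f.TrHull_map g.TrHull_map hull_map_closed f.S)
    qed
    then show ?case
      using fg by (simp add: Sem_nd_def Mon_def concrete_cat_def TrHull_functor_def)
  qed
qed

lemma is_functor_forget: "is_functor Mon Sem forget_functor"
proof -
  interpret Mon: category Mon by (rule category_Mon)
  interpret Sem: category Sem by (rule category_Sem)
  show ?thesis
    by unfold_locales
      (auto simp: Mon_def Sem_def concrete_cat_def forget_functor_def forget_def is_sgrp_def
        sgrp_hom_def mon_hom_def hom_def PiE_iff monoid.m_closed monoid.m_assoc)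
qed

section \<open>The inclusion of \<open>Sem_nd\<close> into \<open>Sem\<close>\<close>

lemma is_functor_J: "is_functor Sem_nd Sem J_functor"
proof -
  interpret nd: category Sem_nd by (rule category_Sem_nd)
  interpret Sem: category Sem by (rule category_Sem)
  show ?thesis
    by unfold_locales (auto simp: Sem_nd_def Sem_def concrete_cat_def J_functor_def)
qed

lemma embedding_functor_J: "embedding_functor Sem_nd Sem J_functor"
  by (simp add: embedding_functor_def is_functor_J) (simp add: J_functor_def)

text \<open>With an empty source there are no products \<open>f s \<star> t\<close>, so no map into
  a nonempty semigroup is nondegenerate. Taking \<open>undefined\<close> as the only element of
  \<open>B\<close> gives the example over every type.\<close>

lemma not_full_functor_J: "\<not> full_functor Sem_nd Sem J_functor"
proof
  assume full: "full_functor (Sem_nd :: ('a sgrp, 'a sgrp_arrow) cat) Sem J_functor"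
  define A :: "'a sgrp" where "A = \<lparr>carrier = {}, sop = \<lambda>_ _. undefined\<rparr>"
  define B :: "'a sgrp" where "B = \<lparr>carrier = {undefined}, sop = \<lambda>_ _. undefined\<rparr>"
  \<comment> \<open>The constant \<open>undefined\<close> is the only extensional function on the
    empty carrier.\<close>
  define g :: "'a sgrp_arrow" where "g = \<lparr>src = A, fn = \<lambda>_. undefined, trg = B\<rparr>"
  have "A \<in> Obj Sem_nd" "B \<in> Obj Sem_nd"
    by (auto simp: A_def B_def Sem_nd_def concrete_cat_def is_sgrp_def globally_idempotent_def
        nondegenerate_def)
  moreover have "g \<in> Arr Sem" "Dom Sem g = A" "Cod Sem g = B"
    by (auto simp: g_def A_def B_def Sem_def concrete_cat_def is_sgrp_def sgrp_hom_def)
  ultimately obtain f where "f \<in> Arr Sem_nd" "Dom Sem_nd f = A" "Cod Sem_nd f = B"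
    using full unfolding full_functor_def J_functor_def by auto
  then have "nondegenerate_map A B (fn f)"
    by (auto simp: Sem_nd_def concrete_cat_def)
  then show False
    by (auto simp: nondegenerate_map_def A_def B_def)
qed

section \<open>Transport along injections\<close>

lemma is_sgrp_copy:
  assumes "inj \<iota>" "is_sgrp S"
  shows "is_sgrp (copy_sgrp \<iota> S)"
  using assms by (auto simp: is_sgrp_def copy_sgrp_def the_inv_f_f)

lemma copy_arrow_closed:
  assumes "inj \<iota>" "inj \<kappa>" "is_sgrp S" "is_sgrp T" "f \<in> sgrp_hom S T"
  shows "copy_arrow \<iota> \<kappa> S T f \<in> Arr Sem"
proof -
  have "(\<lambda>x\<in>\<iota> ` carrier S. \<kappa> (f (the_inv \<iota> x))) \<in> sgrp_hom (copy_sgrp \<iota> S) (copy_sgrp \<kappa> T)"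
    using assms by (auto simp: sgrp_hom_def copy_sgrp_def the_inv_f_f is_sgrp_def)
  then show ?thesis
    using assms by (simp add: Sem_def concrete_cat_def copy_arrow_def is_sgrp_copy)
qed

text \<open>In the middle \<open>the_inv \<kappa>\<close> cancels \<kappa>, and the typing of
  \<open>f\<close> keeps the intermediate value in the domain of the second arrow. Separate
  injections at the three objects let the rule apply to naturality squares, which pass from \<iota>
  to \<kappa>.\<close>

lemma copy_arrow_comp:
  assumes "inj \<iota>" "inj \<kappa>" "f \<in> carrier S \<rightarrow> carrier T"
  shows "copy_arrow \<kappa> \<mu> T V g \<cdot>\<^bsub>Sem\<^esub> copy_arrow \<iota> \<kappa> S T f
    = copy_arrow \<iota> \<mu> S V (compose (carrier S) g f)"
  using assms
  by (auto simp: Sem_def concrete_cat_def copy_arrow_def copy_sgrp_def compose_def fun_eq_iff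
      the_inv_f_f)

lemma is_functor_copy:
  assumes "inj \<iota>"
  shows "is_functor Sem Sem (copy_functor \<iota>)"
proof -
  interpret dom: category "Sem :: ('a sgrp, 'a sgrp_arrow) cat" by (rule category_Sem)
  interpret cod: category "Sem :: ('b sgrp, 'b sgrp_arrow) cat" by (rule category_Sem)
  show ?thesis
  proof (unfold_locales, goal_cases)
    case (1 a)
    then show ?case
      using assms by (simp add: Sem_def concrete_cat_def copy_functor_def is_sgrp_copy)
  next
    case (2 f)
    then have "is_sgrp (src f)" "is_sgrp (trg f)" "fn f \<in> sgrp_hom (src f) (trg f)"
      by (simp_all add: Sem_def concrete_cat_def)
    then show ?case
      using assms by (simp add: copy_functor_def copy_arrow_closed)
  next
    case (3 f)
    then show ?case by (simp add: Sem_def concrete_cat_def copy_functor_def copy_arrow_def)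
  next
    case (4 f)
    then show ?case by (simp add: Sem_def concrete_cat_def copy_functor_def copy_arrow_def)
  next
    case (5 a)
    then show ?case
      using assms
      by (auto simp: Sem_def concrete_cat_def copy_functor_def copy_arrow_def copy_sgrp_def
          the_inv_f_f fun_eq_iff)
  next
    case (6 f g)
    then have "fn f \<in> carrier (src f) \<rightarrow> carrier (src g)" "trg f = src g"
      by (auto simp: Sem_def concrete_cat_def sgrp_hom_def)
    then show ?case
      using copy_arrow_comp[OF assms assms, of "fn f" "src f" "src g" \<iota> "trg g" "fn g"]
      by (simp add: copy_functor_def) (simp add: Sem_def concrete_cat_def)
  qed
qed

section \<open>Functoriality and naturality over a common element type\<close>

theorem corollary58:
  fixes \<iota> :: "'a \<Rightarrow> 'u" and \<kappa> :: "'a hull \<Rightarrow> 'u"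
  assumes "inj \<iota>" and "inj \<kappa>"
  shows "is_functor (Sem_nd :: ('a sgrp, 'a sgrp_arrow) cat)
           (Mon :: ('a hull monoid, 'a hull mon_arrow) cat) TrHull_functor
       \<and> is_functor (Mon :: ('a hull monoid, 'a hull mon_arrow) cat) Sem forget_functor
       \<and> embedding_functor (Sem_nd :: ('a sgrp, 'a sgrp_arrow) cat) Sem J_functor
       \<and> \<not> full_functor (Sem_nd :: ('a sgrp, 'a sgrp_arrow) cat) Sem J_functor
       \<and> natural_transformation (Sem_nd :: ('a sgrp, 'a sgrp_arrow) cat)
           (Sem :: ('u sgrp, 'u sgrp_arrow) cat)
           (copy_functor \<iota> \<circ>\<^sub>F J_functor)
           (copy_functor \<kappa> \<circ>\<^sub>F forget_functor \<circ>\<^sub>F TrHull_functor)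
           (hull_component \<iota> \<kappa>)"
proof (intro conjI)
  interpret F: is_functor Sem_nd Sem "copy_functor \<iota> \<circ>\<^sub>F J_functor"
    by (rule is_functor_fcomp[OF is_functor_J is_functor_copy[OF assms(1)]])
  interpret G: is_functor Sem_nd Sem "copy_functor \<kappa> \<circ>\<^sub>F forget_functor \<circ>\<^sub>F TrHull_functor"
    by (rule is_functor_fcomp[OF is_functor_fcomp[OF is_functor_TrHull is_functor_forget]
          is_functor_copy[OF assms(2)]])
  show "natural_transformation Sem_nd Sem (copy_functor \<iota> \<circ>\<^sub>F J_functor)
      (copy_functor \<kappa> \<circ>\<^sub>F forget_functor \<circ>\<^sub>F TrHull_functor) (hull_component \<iota> \<kappa>)"
  proof (unfold_locales, goal_cases)
    case (1 a)
    then have a: "is_sgrp a"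
      by (simp add: Sem_nd_def concrete_cat_def)
    then have "is_sgrp (forget (TrHull a))"
      using monoid_TrHull[OF a]
      by (simp add: is_sgrp_def forget_def monoid.m_closed monoid.m_assoc)
    with a show ?case
      by (simp add: hull_component_def copy_arrow_closed assms hull_map_sgrp_hom)
  next
    case (2 a)
    then show ?case
      by (simp add: hull_component_def copy_arrow_def fcomp_def copy_functor_def J_functor_def
          Sem_def concrete_cat_def)
  next
    case (3 a)
    then show ?case
      by (simp add: hull_component_def copy_arrow_def fcomp_def copy_functor_def
          forget_functor_def TrHull_functor_def Sem_def concrete_cat_def)
  next
    case (4 f)
    interpret nondegenerate_hom "src f" "trg f" "fn f" by (rule Sem_nd_arrow[OF 4])
    have "\<MM> (src f) \<in> carrier (src f) \<rightarrow> carrier (forget (TrHull (src f)))"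
      using hull_map_sgrp_hom[OF S] by (auto simp: sgrp_hom_def)
    moreover have "fn f \<in> carrier (src f) \<rightarrow> carrier (trg f)"
      by simp
    \<comment> \<open>This is the naturality square before transport, namely the compatibility of
      \<open>TrHull_map\<close> with \<MM>; \<open>copy_arrow_comp\<close> carries it over to the
      common type.\<close>
    moreover have "compose (carrier (src f)) (TrHull_map (src f) (trg f) (fn f)) (\<MM> (src f))
        = compose (carrier (src f)) (\<MM> (trg f)) (fn f)"
      by (simp add: compose_def fun_eq_iff TrHull_map)
    moreover have "Dom Sem_nd f = src f" "Cod Sem_nd f = trg f"
      by (simp_all add: Sem_nd_def concrete_cat_def)
    ultimately show ?case
      by (simp add: hull_component_def fcomp_def copy_functor_def J_functor_def
          forget_functor_def TrHull_functor_def copy_arrow_comp assms)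
  qed
qed (rule is_functor_TrHull is_functor_forget embedding_functor_J not_full_functor_J)+

end
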